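(* If $X\subset\mathbb{R}$ is infinite, then there is a nowhere dense Lebesgue null set $Y\subset\mathbb{R}$ and an increasing bijection $\varphi$ from $X$ onto $Y$, which is a homeomorphism from $X$ onto $Y$ when $X$ is totally disconnected, such that $\mathbb{R}$ can be partitioned into $\mathbf{c}$ translates $\xi+Y$ of $Y$ (i.e. there is a set $S\subset\mathbb{R}$ such that $\{\xi+Y \mid \xi\in S\}$ is a partition of $\mathbb{R}$ with exactly $\mathbf{c}$ members).
   Context: $\mathbf{c}=2^{\aleph_0}=|\mathbb{R}|$. Subsets of $\mathbb{R}$ carry the subspace topology. A subset of $\mathbb{R}$ is totally disconnected if and only if it contains no nondegenerate interval. For $\xi\in\mathbb{R}$, $\xi+Y=\{\xi+y\mid y\in Y\}$. *)

theory Defs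
  imports "HOL-Analysis.Analysis" "HOL-Library.Equipollence" "HOL-Library.Disjoint_Sets"
begin

definition nowhere_dense :: "'a::topological_space set \<Rightarrow> bool"
  where "nowhere_dense A \<longleftrightarrow> interior (closure A) = {}"

definition totally_disconnected :: "'a::topological_space set \<Rightarrow> bool"
  where "totally_disconnected A \<longleftrightarrow> (\<forall>C\<in>components A. \<exists>x. C = {x})"

lemma totally_disconnected_real_iff:
  fixes A :: "real set"
  shows "totally_disconnected A \<longleftrightarrow> \<not> (\<exists>a b. a < b \<and> {a..b} \<subseteq> A)"
proof
  assume td: "totally_disconnected A"
  show "\<not> (\<exists>a b. a < b \<and> {a..b} \<subseteq> A)"
  proof
    assume "\<exists>a b. a < b \<and> {a..b} \<subseteq> A"
    then obtain a b where ab: "a < b" "{a..b} \<subseteq> A" by blast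
    then have "connected_component A a a" "connected_component A a b"
      by (auto intro!: connected_componentI[of "{a..b}"])
    moreover have "a \<in> A" using ab by auto
    then obtain x where "connected_component_set A a = {x}"
      using td by (auto simp: totally_disconnected_def components_def)
    ultimately have "a = x" "b = x" by blast+
    with ab show False by simp
  qed
next
  assume no: "\<not> (\<exists>a b. a < b \<and> {a..b} \<subseteq> A)"
  show "totally_disconnected A"
    unfolding totally_disconnected_def
  proof
    fix C assume C: "C \<in> components A"
    then have "connected C" "C \<subseteq> A" "C \<noteq> {}"
      by (auto simp: in_components_connected in_components_subset in_components_nonempty)
    have "\<not> x < y" if "x \<in> C" "y \<in> C" for x y
    proof
      assume "x < y"
      have "{x..y} \<subseteq> C"
        using connected_contains_Icc[OF \<open>connected C\<close>] that by blast
      with \<open>C \<subseteq> A\<close> \<open>x < y\<close> no show False by blast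
    qed
    then have "x = y" if "x \<in> C" "y \<in> C" for x y
      using that by (meson linorder_neqE)
    with \<open>C \<noteq> {}\<close> show "\<exists>x. C = {x}" by blast
  qed
qed

end

theory Submission
  imports Defs "HOL-Library.Multiset"
begin

text \<open>Take \<open>Y = \<phi> ` X\<close> with \<open>\<phi> x = (\<Sum>n. [d n < x] / 5^n)\<close> for a dense sequence \<open>d\<close>, chosen outside \<open>X\<close>
  when \<open>X\<close> is totally disconnected, so that \<open>\<phi>\<close> is continuous on \<open>X\<close>; the inverse of a strictly
  increasing function on the line is always continuous. The values of \<open>\<phi>\<close> lie in a null Cantor set and
  satisfy no nontrivial relation \<open>a + b + c = a' + b' + c'\<close>, since base-five digits at most 3 are
  determined by the sum. Hence a point \<open>z \<notin> Y\<close> has the form \<open>u + v - w\<close> with entries in \<open>Y\<close> for at most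
  two values of \<open>u\<close>, and a transfinite recursion of length \<open>|Y|\<close> tiles the group generated by \<open>Y\<close>, and so
  each of its cosets. Distinct points \<open>y + y\<close> with \<open>y \<in> Y\<close> lie in distinct tiles, so there are at least
  \<open>|Y|\<close> tiles; as the tiles cover the line, there are continuum many.\<close>

section \<open>Tilings by Sidon sets\<close>

text \<open>The B_3 sets of additive combinatorics; multisets compare the summands up to order, with
  repetitions counted.\<close>

definition sidon3 :: "'a::ab_group_add set \<Rightarrow> bool" where
  "sidon3 Y \<longleftrightarrow> (\<forall>a\<in>Y. \<forall>b\<in>Y. \<forall>c\<in>Y. \<forall>d\<in>Y. \<forall>e\<in>Y. \<forall>f\<in>Y.
     a + b + c = d + e + f \<longrightarrow> {#a, b, c#} = {#d, e, f#})"

lemma sidon3D: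
  assumes "sidon3 Y" "a \<in> Y" "b \<in> Y" "c \<in> Y" "d \<in> Y" "e \<in> Y" "f \<in> Y" "a + b + c = d + e + f"
  shows "{#a, b, c#} = {#d, e, f#}"
  using assms unfolding sidon3_def by blast

lemma sidon3_subset: "sidon3 Y \<Longrightarrow> Z \<subseteq> Y \<Longrightarrow> sidon3 Z"
  unfolding sidon3_def by (meson subsetD)

text \<open>Fix one representation \<open>a + b - c\<close>. Comparing any other with it gives an
  equality of three-term sums, which leaves \<open>u\<close> only the choices \<open>a\<close>,
  \<open>b\<close> and \<open>w\<close>.\<close>

lemma sidon3_finite_representations:
  assumes Y: "sidon3 Y" and z: "z \<notin> Y"
  shows "finite {u \<in> Y. \<exists>v\<in>Y. \<exists>w\<in>Y. z = u + v - w}" (is "finite ?B")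
proof (cases "?B = {}")
  case False
  then obtain a b c where abc: "a \<in> Y" "b \<in> Y" "c \<in> Y" "z = a + b - c" by blast
  have "u \<in> {a, b}" if "u \<in> Y" "v \<in> Y" "w \<in> Y" "z = u + v - w" for u v w
  proof -
    have "a + b = z + c" using abc(4) by simp
    moreover have "u + v = z + w" using that(4) by simp
    ultimately have "a + b + w = u + v + c" by (simp add: ac_simps)
    then have "{#a, b, w#} = {#u, v, c#}"
      using sidon3D[OF Y] abc that by blast
    then have "set_mset {#a, b, w#} = set_mset {#u, v, c#}" by simp
    then have "u \<in> {a, b, w}" by auto
    \<comment> \<open>If \<open>u = w\<close>, then \<open>z = v\<close> would lie in
      \<open>Y\<close>.\<close>
    moreover have "u \<noteq> w" using that z by auto
    ultimately show ?thesis by blast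
  qed
  then have "?B \<subseteq> {a, b}" by blast
  then show ?thesis by (rule finite_subset) simp
qed (metis finite.emptyI)

section \<open>Cardinal arithmetic and the transfinite tiling\<close>

context includes cardinal_syntax
begin

text \<open>Closing under differences countably often keeps an infinite cardinality. That
  \<open>G\<close> is no larger than \<open>Y\<close> bounds the number of predecessors in the later
  recursion along \<open>G\<close>.\<close>

lemma generated_subgroup_card:
  fixes Y :: "'a::ab_group_add set"
  assumes inf: "infinite Y"
  obtains G where "Y \<subseteq> G" "0 \<in> G" "\<And>x y. x \<in> G \<Longrightarrow> y \<in> G \<Longrightarrow> x - y \<in> G" "G \<approx> Y"
proof -
  define D where "D = rec_nat (insert (0::'a) Y) (\<lambda>_ A. (\<lambda>(a, b). a - b) ` (A \<times> A))"
  have D0: "D 0 = insert 0 Y" and DS: "D (Suc n) = (\<lambda>(a, b). a - b) ` (D n \<times> D n)" for n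
    by (auto simp: D_def)
  have zero: "0 \<in> D n" for n
    by (induction n) (auto simp: D0 DS intro!: image_eqI[of _ _ "(0, 0)"])
  \<comment> \<open>Since \<open>0\<close> is in every stage, \<open>x = x - 0\<close> survives to
    the next.\<close>
  have "D n \<subseteq> D (Suc n)" for n
    using zero[of n] by (auto simp: DS intro!: image_eqI[of _ _ "(_, 0)"])
  then have mono: "D m \<subseteq> D n" if "m \<le> n" for m n
    using lift_Suc_mono_le[of D] that by blast
  have card_D: "|D n| \<le>o |Y|" for n
  proof (induction n)
    case 0
    show ?case
      using infinite_insert_eqpoll[OF inf, of 0] unfolding D0 eqpoll_iff_card_of_ordIso
      by (rule ordIso_imp_ordLeq)
  next
    case (Suc n)
    have "|D (Suc n)| \<le>o |D n \<times> D n|" unfolding DS by (rule card_of_image)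
    also have "|D n \<times> D n| \<le>o |Y \<times> Y|"
      using Suc ordLeq_transitive[OF card_of_Times_mono1 card_of_Times_mono2] by blast
    also have "ordIso2 (card_of (Y \<times> Y)) (card_of Y)" using inf by (rule card_of_Times_same_infinite)
    finally show ?case .
  qed
  show thesis
  proof
    show YG: "Y \<subseteq> (\<Union>n. D n)" using D0 by blast
    show "0 \<in> (\<Union>n. D n)" using zero by blast
    show "x - y \<in> (\<Union>n. D n)" if xy: "x \<in> (\<Union>n. D n)" "y \<in> (\<Union>n. D n)" for x y
    proof -
      obtain m n where "x \<in> D m" "y \<in> D n" using xy by blast
      then have "x \<in> D (max m n)" "y \<in> D (max m n)"
        using mono[of m "max m n"] mono[of n "max m n"] by auto
      then have "x - y \<in> D (Suc (max m n))" unfolding DS by force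
      then show ?thesis by blast
    qed
    have "|\<Union>n. D n| \<le>o |Y|"
      using inf infinite_iff_card_of_nat card_D by (intro card_of_UNION_ordLeq_infinite) auto
    then show "(\<Union>n. D n) \<approx> Y"
      using card_of_mono1[OF YG] by (simp add: eqpoll_iff_card_of_ordIso ordIso_iff_ordLeq)
  qed
qed

text \<open>For finite \<open>I\<close> the union is finite; for infinite \<open>I\<close> it has at
  most \<open>|I|\<close> elements.\<close>

lemma UN_finite_ordLess_infinite:
  assumes "infinite Y" "|I| <o |Y|" "\<And>i. i \<in> I \<Longrightarrow> finite (A i)"
  shows "|\<Union>i\<in>I. A i| <o |Y|"
proof (cases "finite I")
  case True
  then have "finite (\<Union>i\<in>I. A i)" using assms by auto
  then have "\<not> |Y| \<le>o |\<Union>i\<in>I. A i|" using assms(1) card_of_ordLeq_finite by blast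
  then show ?thesis using not_ordLeq_iff_ordLess[OF card_of_Well_order card_of_Well_order] by blast
next
  case False
  have "|A i| \<le>o |I|" if "i \<in> I" for i
    using finite_lepoll_infinite[OF False assms(3)[OF that]]
    by (simp add: lepoll_def card_of_ordLeq)
  then have "|\<Union>i\<in>I. A i| \<le>o |I|"
    using False card_of_mono1[of I I] by (intro card_of_UNION_ordLeq_infinite) auto
  then show ?thesis using assms(2) ordLeq_ordLess_trans by blast
qed

text \<open>Transfinite recursion along a well-order of \<open>G\<close> of minimal length. At stage \<open>a\<close> a translate
  covering \<open>a\<close> is chosen; fewer than \<open>|Y|\<close> earlier translates each exclude only finitely many of the
  \<open>|Y|\<close> candidates.\<close>

lemma sidon3_tiles_subgroup:
  fixes Y :: "'a::ab_group_add set"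
  assumes Y: "sidon3 Y" and inf: "infinite Y" and YG: "Y \<subseteq> G"
    and diff: "\<And>x y. x \<in> G \<Longrightarrow> y \<in> G \<Longrightarrow> x - y \<in> G" and eqp: "G \<approx> Y"
  shows "\<exists>S\<subseteq>G. \<forall>x\<in>G. \<exists>!s. s \<in> S \<and> x - s \<in> Y"
proof -
  have card: "ordIso2 (card_of G) (card_of Y)" using eqp by (simp add: eqpoll_iff_card_of_ordIso)
  define r where "r = |G|"
  \<comment> \<open>\<open>Q\<close> keeps tiles with distinct offsets disjoint. \<open>P\<close> is
    the requirement on stage \<open>a\<close>, vacuous outside \<open>G\<close> because the
    recursion yields a total function.\<close>
  define Q where "Q = (\<lambda>s t. s = t \<or> (\<forall>u\<in>Y. \<forall>v\<in>Y. s + u \<noteq> t + v))"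
  define P where "P = (\<lambda>f a s. a \<in> G \<longrightarrow> a - s \<in> Y \<and> (\<forall>b\<in>underS r a. Q (f b) s))"
  have wo: "Well_order r" and co: "Card_order r" and F: "Field r = G"
    unfolding r_def by (rule card_of_Well_order card_of_Card_order Field_card_of)+
  have uG: "underS r a \<subseteq> G" for a
    using F by (auto simp: underS_def Field_def)
  have uS: "b \<in> underS r a \<longleftrightarrow> (b, a) \<in> r - Id" for a b
    by (auto simp: underS_def)
  have tot: "a = b \<or> a \<in> underS r b \<or> b \<in> underS r a" if "a \<in> G" "b \<in> G" for a b
    using wo that F unfolding well_order_on_def linear_order_on_def total_on_def underS_def by blast
  have Qsym: "Q s t \<Longrightarrow> Q t s" for s t unfolding Q_def by metis
  have "\<exists>f. \<forall>x. P f x (f x)"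
  proof (rule dependent_wf_choice)
    show "wf (r - Id)" using wo by (simp add: well_order_on_def)
    show "P f x s = P g x s" if "\<And>z. (z, x) \<in> r - Id \<Longrightarrow> f z = g z" for f g x s
      using that by (simp add: P_def uS)
    show "\<exists>s. P f a s" if IH: "\<And>b. (b, a) \<in> r - Id \<Longrightarrow> P f b (f b)" for a f
    proof (cases "a \<in> G")
      case aG: True
      have Pb: "P f b (f b)" if "b \<in> underS r a" for b using IH that uS by blast
      show ?thesis
      \<comment> \<open>An earlier tile that already covers \<open>a\<close> is reused; the
        alternative \<open>s = t\<close> in \<open>Q\<close> allows for this.\<close>
      proof (cases "\<exists>b\<in>underS r a. a - f b \<in> Y")
        case True
        then obtain b where b: "b \<in> underS r a" "a - f b \<in> Y" by blast
        have "Q (f c) (f b)" if c: "c \<in> underS r a" for c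
        proof -
          have "c \<in> G" "b \<in> G" using uG b c by auto
          with tot[of c b] Pb[OF c] Pb[OF b(1)] show ?thesis
            by (auto simp: P_def intro: Qsym) (simp add: Q_def)
        qed
        with b show ?thesis unfolding P_def by blast
      next
        case False
        \<comment> \<open>\<open>B b\<close> collects the \<open>u\<close> for which the tile at
          \<open>a - u\<close> would meet the tile at \<open>f b\<close>. It is finite because
          \<open>a - f b\<close> is outside \<open>Y\<close>.\<close>
        define B where "B = (\<lambda>b. {u \<in> Y. \<exists>v\<in>Y. \<exists>w\<in>Y. a - f b = u + v - w})"
        have "finite (B b)" if "b \<in> underS r a" for b
          unfolding B_def using False Y that by (intro sidon3_finite_representations) auto
        moreover have "|underS r a| <o |Y|"
          using card_of_underS[OF co, of a] aG F card ordLess_ordIso_trans unfolding r_def by blast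
        ultimately have "|\<Union>b\<in>underS r a. B b| <o |Y|"
          by (intro UN_finite_ordLess_infinite inf)
        then have "\<not> Y \<subseteq> (\<Union>b\<in>underS r a. B b)"
          using card_of_mono1 not_ordLess_ordLeq by blast
        then obtain y where y: "y \<in> Y" "\<And>b. b \<in> underS r a \<Longrightarrow> y \<notin> B b" by blast
        have "Q (f b) (a - y)" if "b \<in> underS r a" for b
          unfolding Q_def
        proof (intro disjI2 ballI notI)
          fix u v assume uv: "u \<in> Y" "v \<in> Y" "f b + u = a - y + v"
          have "a = (a - y + v) - v + y" by simp
          also have "\<dots> = f b + (y + u - v)" unfolding uv(3)[symmetric] by (simp add: algebra_simps)
          finally have "a - f b = y + u - v" by (metis add_diff_cancel_left')
          with uv y(1) have "y \<in> B b" unfolding B_def by blast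
          with y(2)[OF that] show False ..
        qed
        with y(1) have "P f a (a - y)" by (simp add: P_def)
        then show ?thesis ..
      qed
    qed (simp add: P_def)
  qed
  then obtain f where f: "\<And>x. P f x (f x)" by blast
  have Qf: "Q (f a) (f b)" if "a \<in> G" "b \<in> G" for a b
    using tot[OF that] f[of a] f[of b] that by (auto simp: P_def intro: Qsym) (simp add: Q_def)
  have cov: "a - f a \<in> Y" if "a \<in> G" for a using f[of a] that by (simp add: P_def)
  have "f ` G \<subseteq> G"
  proof (rule image_subsetI)
    fix a assume "a \<in> G"
    then have "a - (a - f a) \<in> G" using cov YG diff by blast
    then show "f a \<in> G" by simp
  qed
  moreover have "\<exists>!s. s \<in> f ` G \<and> x - s \<in> Y" if x: "x \<in> G" for x
  proof (rule ex1I[of _ "f x"])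
    fix s assume s: "s \<in> f ` G \<and> x - s \<in> Y"
    then have "Q s (f x)" using Qf x by blast
    moreover have "s + (x - s) = f x + (x - f x)" by simp
    ultimately show "s = f x" using s cov[OF x] unfolding Q_def by blast
  qed (use x cov in auto)
  ultimately show ?thesis by (intro exI[of _ "f ` G"] conjI ballI)
qed

text \<open>Translating a tiling of \<open>G\<close> by coset representatives tiles every coset;
  tiles in different cosets cannot meet, since \<open>S\<close> and \<open>Y\<close> lie in
  \<open>G\<close>.\<close>

lemma sidon3_tiles:
  fixes Y :: "'a::ab_group_add set"
  assumes Y: "sidon3 Y" and inf: "infinite Y"
  shows "\<exists>S. \<forall>x. \<exists>!s. s \<in> S \<and> x - s \<in> Y"
proof -
  obtain G where G: "Y \<subseteq> G" "0 \<in> G" "\<And>x y. x \<in> G \<Longrightarrow> y \<in> G \<Longrightarrow> x - y \<in> G" "G \<approx> Y"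
    by (rule generated_subgroup_card[OF inf], rule that)
  have "\<exists>S\<subseteq>G. \<forall>x\<in>G. \<exists>!s. s \<in> S \<and> x - s \<in> Y"
    using Y inf G(1,3,4) by (rule sidon3_tiles_subgroup)
  then obtain S where S: "S \<subseteq> G" "\<And>x. x \<in> G \<Longrightarrow> \<exists>!s. s \<in> S \<and> x - s \<in> Y"
    by auto
  have uminus: "- x \<in> G" if "x \<in> G" for x using G(3)[OF G(2) that] by simp
  have plus: "x + y \<in> G" if "x \<in> G" "y \<in> G" for x y using G(3)[OF that(1) uminus[OF that(2)]] by simp
  define \<rho> where "\<rho> = (\<lambda>x. SOME y. x - y \<in> G)"
  have \<rho>: "x - \<rho> x \<in> G" for x
    unfolding \<rho>_def by (rule someI[of _ x]) (simp add: G(2))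
  \<comment> \<open>The choice depends only on the coset, because equivalent arguments give
    \<open>SOME\<close> the same predicate.\<close>
  have \<rho>_eq: "\<rho> x = \<rho> y" if xy: "x - y \<in> G" for x y
  proof -
    have "x - z \<in> G \<longleftrightarrow> y - z \<in> G" for z
      using G(3)[OF _ xy, of "x - z"] plus[OF xy, of "y - z"] by auto
    then show ?thesis by (simp add: \<rho>_def)
  qed
  define T where "T = (\<lambda>(t, s). t + s) ` (range \<rho> \<times> S)"
  have "\<exists>!s. s \<in> T \<and> x - s \<in> Y" for x
  proof -
    obtain s where s: "s \<in> S" "x - \<rho> x - s \<in> Y"
      "\<And>s'. s' \<in> S \<Longrightarrow> x - \<rho> x - s' \<in> Y \<Longrightarrow> s' = s"
      using S(2)[OF \<rho>[of x]] by blast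
    show ?thesis
    proof (rule ex1I[of _ "\<rho> x + s"])
      show "\<rho> x + s \<in> T \<and> x - (\<rho> x + s) \<in> Y"
        using s(1,2) by (auto simp: T_def diff_diff_add)
    next
      fix t assume t: "t \<in> T \<and> x - t \<in> Y"
      then obtain z s' where z: "s' \<in> S" "t = \<rho> z + s'" by (auto simp: T_def)
      have "x - \<rho> z = (x - t) + s'" using z by simp
      also have "\<dots> \<in> G" using plus t z S(1) G(1) by blast
      finally have "(x - \<rho> z) - (z - \<rho> z) \<in> G" using \<rho> G(3) by blast
      then have "\<rho> z = \<rho> x" using \<rho>_eq[of x z] by simp
      then show "t = \<rho> x + s" using s(3)[of s'] t z by (simp add: diff_diff_add)
    qed
  qed
  then show ?thesis by (intro exI[of _ T] allI)
qed

end

section \<open>Counting the tiles\<close>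

lemma sidon3_tiling_eqpoll:
  fixes Y :: "'a::ab_group_add set"
  assumes Y: "sidon3 Y" and inf: "infinite Y" and S: "\<And>x. \<exists>!s. s \<in> S \<and> x - s \<in> Y"
  shows "S \<approx> (UNIV :: 'a set)"
proof -
  define \<sigma> where "\<sigma> = (\<lambda>x. THE s. s \<in> S \<and> x - s \<in> Y)"
  have \<sigma>: "\<sigma> x \<in> S" "x - \<sigma> x \<in> Y" for x
    using theI'[OF S, of x] unfolding \<sigma>_def by auto
  have "inj_on (\<lambda>y. \<sigma> (y + y)) Y"
  proof (rule inj_onI)
    fix y w assume yw: "y \<in> Y" "w \<in> Y" "\<sigma> (y + y) = \<sigma> (w + w)"
    let ?a = "y + y - \<sigma> (y + y)" and ?b = "w + w - \<sigma> (w + w)"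
    have "y + y + ?b = w + w + ?a" using yw(3) by (simp add: algebra_simps)
    then have "{#y, y, ?b#} = {#w, w, ?a#}" using sidon3D[OF Y] yw \<sigma>(2) by blast
    \<comment> \<open>Were \<open>y\<close> and \<open>w\<close> distinct, \<open>w\<close> would
      occur at most once on the left and at least twice on the right.\<close>
    then have "count {#y, y, ?b#} w = count {#w, w, ?a#} w" by (rule arg_cong)
    then show "y = w" by (auto split: if_splits)
  qed
  then have YS: "Y \<lesssim> S" using \<sigma>(1) unfolding lepoll_def by blast
  then have infS: "infinite S" using inf finite_lepoll_infinite
    by (metis lepoll_iff finite_surj)
  \<comment> \<open>A point is the sum of its tile's offset and its position in the tile.\<close>
  have "inj (\<lambda>x. (\<sigma> x, x - \<sigma> x))" by (auto simp: inj_on_def)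
  then have "(UNIV :: 'a set) \<lesssim> S \<times> Y" using \<sigma> unfolding lepoll_def by blast
  also have "S \<times> Y \<lesssim> S \<times> S" using YS by (intro times_lepoll_mono) auto
  also have "S \<times> S \<approx> S"
    using card_of_Times_same_infinite[OF infS] by (simp add: eqpoll_iff_card_of_ordIso)
  finally have "(UNIV :: 'a set) \<lesssim> S" .
  then show ?thesis by (rule lepoll_antisym[OF subset_imp_lepoll[OF subset_UNIV]])
qed

text \<open>Injectivity lets the number of tiles be read off from \<open>S\<close>.\<close>

lemma partition_translates:
  fixes Y :: "'a::ab_group_add set"
  assumes "Y \<noteq> {}" and S: "\<And>x. \<exists>!s. s \<in> S \<and> x - s \<in> Y"
  shows "partition_on UNIV ((\<lambda>\<xi>. (+) \<xi> ` Y) ` S)" and "inj_on (\<lambda>\<xi>. (+) \<xi> ` Y) S"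
proof -
  have mem: "x \<in> (+) s ` Y \<longleftrightarrow> x - s \<in> Y" for x s
    by (force simp: image_iff)
  have eq: "s = t" if "s \<in> S" "t \<in> S" "x \<in> (+) s ` Y" "x \<in> (+) t ` Y" for s t x
    using ex1E[OF S[of x]] that unfolding mem by metis
  have ex: "\<exists>s\<in>S. x \<in> (+) s ` Y" for x
    using ex1_implies_ex[OF S[of x]] unfolding mem by blast
  show "partition_on UNIV ((\<lambda>\<xi>. (+) \<xi> ` Y) ` S)"
  proof (rule partition_onI)
    show "\<Union> ((\<lambda>\<xi>. (+) \<xi> ` Y) ` S) = UNIV"
      using ex by fast
    show "{} \<notin> (\<lambda>\<xi>. (+) \<xi> ` Y) ` S" using assms(1) by blast
    show "disjnt p q"
      if "p \<in> (\<lambda>\<xi>. (+) \<xi> ` Y) ` S" "q \<in> (\<lambda>\<xi>. (+) \<xi> ` Y) ` S" "p \<noteq> q" for p q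
    proof -
      obtain s t where st: "s \<in> S" "t \<in> S" "p = (+) s ` Y" "q = (+) t ` Y"
        using \<open>p \<in> _\<close> \<open>q \<in> _\<close> by blast
      then show ?thesis using eq[OF st(1,2)] \<open>p \<noteq> q\<close> unfolding disjnt_iff by blast
    qed
  qed
  show "inj_on (\<lambda>\<xi>. (+) \<xi> ` Y) S"
  proof (rule inj_onI)
    fix s t assume st: "s \<in> S" "t \<in> S" "(+) s ` Y = (+) t ` Y"
    obtain y where "y \<in> Y" using assms(1) by blast
    then have "s + y \<in> (+) s ` Y" by (rule imageI)
    then show "s = t" using eq st by metis
  qed
qed

section \<open>Base-five expansions with small digits\<close>

lemma base5_digits_sums:
  fixes b :: "nat \<Rightarrow> real"
  assumes "\<And>n. \<bar>b n\<bar> \<le> M"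
  shows "summable (\<lambda>n. b n / 5 ^ n)" and "\<bar>\<Sum>n. b n / 5 ^ n\<bar> \<le> M * 5 / 4"
proof -
  have le: "norm (b n / 5 ^ n) \<le> M * (1 / 5) ^ n" for n
    using assms[of n] by (simp add: power_divide divide_right_mono)
  have sums: "(\<lambda>n. M * (1 / 5) ^ n) sums (M * 5 / 4)"
    using sums_mult[OF geometric_sums[of "1 / 5 :: real"], of M] by simp
  have sn: "summable (\<lambda>n. norm (b n / 5 ^ n))"
    by (rule summable_comparison_test[OF _ sums_summable[OF sums]]) (use le in auto)
  then show "summable (\<lambda>n. b n / 5 ^ n)" by (rule summable_norm_cancel)
  have "\<bar>\<Sum>n. b n / 5 ^ n\<bar> \<le> (\<Sum>n. norm (b n / 5 ^ n))" using summable_norm[OF sn] by simp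
  also have "\<dots> \<le> (\<Sum>n. M * (1 / 5) ^ n)" by (rule suminf_le[OF le sn sums_summable[OF sums]])
  also have "\<dots> = M * 5 / 4" using sums sums_unique by metis
  finally show "\<bar>\<Sum>n. b n / 5 ^ n\<bar> \<le> M * 5 / 4" .
qed

lemma base5_shift:
  fixes b :: "nat \<Rightarrow> real"
  assumes "\<And>n. \<bar>b n\<bar> \<le> M"
  shows "(\<Sum>n. b n / 5 ^ n) = b 0 + (\<Sum>n. b (Suc n) / 5 ^ n) / 5"
proof -
  have "(\<Sum>n. b (Suc n) / 5 ^ n) / 5 = (\<Sum>n. b (Suc n) / 5 ^ Suc n)"
    using suminf_divide[OF base5_digits_sums(1)[of "\<lambda>n. b (Suc n)", OF assms], of 5]
    by (simp add: field_simps)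
  also have "\<dots> = (\<Sum>n. b n / 5 ^ n) - b 0"
    using suminf_split_head[OF base5_digits_sums(1)[OF assms]] by simp
  finally show ?thesis by linarith
qed

text \<open>The terms after \<open>b 0\<close> contribute at most
  \<open>(15/4) / 5 = 3/4 < 1\<close> in modulus, so the integer \<open>b 0\<close> must vanish;
  shifting the sequence repeats the argument.\<close>

lemma base5_digits_zero:
  fixes b :: "nat \<Rightarrow> int"
  assumes "\<And>n. \<bar>b n\<bar> \<le> 3" "(\<Sum>n. real_of_int (b n) / 5 ^ n) = 0"
  shows "b n = 0"
  using assms
proof (induction n arbitrary: b)
  have shift: "(\<Sum>n. real_of_int (b n) / 5 ^ n) = b 0 + (\<Sum>n. real_of_int (b (Suc n)) / 5 ^ n) / 5"
    and bound: "\<bar>\<Sum>n. real_of_int (b n) / 5 ^ n\<bar> \<le> 3 * 5 / 4"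
    if b: "\<And>n. \<bar>b n\<bar> \<le> 3" for b :: "nat \<Rightarrow> int"
  proof -
    have "\<bar>real_of_int (b n)\<bar> \<le> 3" for n using b[of n] by linarith
    note base5_shift[of "\<lambda>n. real_of_int (b n)" 3, OF this]
      base5_digits_sums(2)[of "\<lambda>n. real_of_int (b n)" 3, OF this]
    then show "(\<Sum>n. real_of_int (b n) / 5 ^ n) = b 0 + (\<Sum>n. real_of_int (b (Suc n)) / 5 ^ n) / 5"
      "\<bar>\<Sum>n. real_of_int (b n) / 5 ^ n\<bar> \<le> 3 * 5 / 4" .
  qed
  have zero: "b 0 = 0" if "\<And>n. \<bar>b n\<bar> \<le> 3" "(\<Sum>n. real_of_int (b n) / 5 ^ n) = 0" for b
    using shift[of b, OF that(1)] bound[of "\<lambda>n. b (Suc n)", OF that(1)] that(2) by linarith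
  {
    case 0
    then show ?case using zero by blast
  next
    case (Suc n)
    have "(\<Sum>n. real_of_int (b (Suc n)) / 5 ^ n) = 0"
      using shift[of b, OF Suc.prems(1)] Suc.prems(2) zero[OF Suc.prems] by simp
    then show ?case using Suc.IH[of "\<lambda>n. b (Suc n)"] Suc.prems(1) by blast
  }
qed

section \<open>A null Cantor set of ratio 1/5\<close>

definition base5_cantor :: "real set" where
  "base5_cantor = {\<Sum>n. e n / 5 ^ n | e. range e \<subseteq> {0, 1 :: real}}"

text \<open>The offset \<open>a\<close> is the leading digit; the scaled copy carries the
  others.\<close>

lemma base5_cantor_selfsimilar:
  "base5_cantor \<subseteq> (\<Union>a\<in>{0, 1}. (\<lambda>x. (1 / 5) *\<^sub>R x + a) ` base5_cantor)"
proof
  fix x assume "x \<in> base5_cantor"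
  then obtain e where e: "x = (\<Sum>n. e n / 5 ^ n)" "range e \<subseteq> {0, 1 :: real}"
    by (auto simp: base5_cantor_def)
  have "e n = 0 \<or> e n = 1" for n using e(2) by blast
  then have e1: "\<bar>e n\<bar> \<le> 1" for n by (metis abs_one abs_zero order_refl zero_le_one)
  let ?y = "\<Sum>n. e (Suc n) / 5 ^ n"
  have "?y \<in> base5_cantor"
    using e(2) unfolding base5_cantor_def by (intro CollectI exI[of _ "\<lambda>n. e (Suc n)"]) auto
  moreover have "x = (1 / 5) *\<^sub>R ?y + e 0" using base5_shift[of e 1, OF e1] e(1) by simp
  moreover have "e 0 \<in> {0, 1}" using e(2) by blast
  ultimately show "x \<in> (\<Union>a\<in>{0, 1}. (\<lambda>x. (1 / 5) *\<^sub>R x + a) ` base5_cantor)"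
    by (intro UN_I[of "e 0"] image_eqI[of _ _ ?y])
qed

lemma base5_cantor_bounded: "bounded base5_cantor"
  unfolding bounded_iff
proof (intro exI ballI)
  fix x assume "x \<in> base5_cantor"
  then obtain e where e: "x = (\<Sum>n. e n / 5 ^ n)" "range e \<subseteq> {0, 1 :: real}"
    by (auto simp: base5_cantor_def)
  have "e n = 0 \<or> e n = 1" for n using e(2) by blast
  then have "\<bar>e n\<bar> \<le> 1" for n by (metis abs_one abs_zero order_refl zero_le_one)
  from base5_digits_sums(2)[of e 1, OF this] show "norm x \<le> 5 / 4" using e(1) by simp
qed

text \<open>Two copies shrunk by \<open>1/5\<close> cover the closure, so its measure
  \<open>m\<close> satisfies \<open>m \<le> 2/5 * m\<close>; compactness makes \<open>m\<close>
  finite. Working with the closure yields nowhere density as well as nullity.\<close>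

lemma negligible_closure_base5_cantor: "negligible (closure base5_cantor)"
proof -
  let ?C = "closure base5_cantor"
  let ?h = "\<lambda>a x :: real. (1 / 5) *\<^sub>R x + a"
  have comp: "compact ?C" using base5_cantor_bounded by (simp add: compact_closure)
  then have lm: "?C \<in> lmeasurable" by (rule lmeasurable_compact)
  have comph: "compact (?h a ` ?C)" for a
    by (intro compact_continuous_image comp continuous_intros)
  then have lmh: "?h a ` ?C \<in> lmeasurable" for a by (rule lmeasurable_compact)
  have "?C \<subseteq> ?h 0 ` ?C \<union> ?h 1 ` ?C"
  proof (rule closure_minimal)
    show "base5_cantor \<subseteq> ?h 0 ` ?C \<union> ?h 1 ` ?C"
      using base5_cantor_selfsimilar closure_subset[of base5_cantor] by blast
    show "closed (?h 0 ` ?C \<union> ?h 1 ` ?C)" by (intro closed_Un compact_imp_closed comph)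
  qed
  then have "measure lebesgue ?C \<le> measure lebesgue (?h 0 ` ?C \<union> ?h 1 ` ?C)"
    using lm lmh by (intro measure_mono_fmeasurable fmeasurable.Un fmeasurableD)
  also have "\<dots> \<le> measure lebesgue (?h 0 ` ?C) + measure lebesgue (?h 1 ` ?C)"
    using lmh by (intro measure_Un_le fmeasurableD)
  also have "\<dots> = 2 / 5 * measure lebesgue ?C"
    using measure_lebesgue_affine[of "1/5" 0 ?C] measure_lebesgue_affine[of "1/5" 1 ?C] by simp
  finally have "measure lebesgue ?C = 0" by (simp add: antisym)
  then show ?thesis using lm by (simp add: negligible_iff_measure)
qed

section \<open>A strictly increasing function with jumps on a dense sequence\<close>

text \<open>The distribution function of the measure with mass \<open>1 / 5 ^ n\<close> at
  \<open>d n\<close>; the strict inequality makes it left-continuous.\<close>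

definition jump :: "(nat \<Rightarrow> real) \<Rightarrow> real \<Rightarrow> real" where
  "jump d x = (\<Sum>n. of_bool (d n < x) / 5 ^ n)"

lemma jump_summable: "summable (\<lambda>n. of_bool (d n < x) / 5 ^ n :: real)"
  by (rule base5_digits_sums(1)[of _ 1]) simp

lemma jump_in_cantor: "jump d x \<in> base5_cantor"
  unfolding jump_def base5_cantor_def by auto

locale dense_sequence =
  fixes d :: "nat \<Rightarrow> real"
  assumes dense: "a < b \<Longrightarrow> \<exists>n. a < d n \<and> d n < b"
begin

lemma strict_mono_jump: "strict_mono (jump d)"
proof (rule strict_monoI)
  fix x y :: real assume "x < y"
  then obtain i where i: "x < d i" "d i < y" using dense by blast
  have "0 < (\<Sum>n. of_bool (d n < y) / 5 ^ n - of_bool (d n < x) / 5 ^ n :: real)"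
    using \<open>x < y\<close> i
    by (intro suminf_pos2[where i=i] summable_diff jump_summable) auto
  also have "\<dots> = jump d y - jump d x"
    unfolding jump_def by (rule suminf_diff[symmetric]; rule jump_summable)
  finally show "jump d x < jump d y" by simp
qed

text \<open>Discontinuities can occur only at the points \<open>d n\<close>: each partial sum is
  continuous off them, and convergence is uniform.\<close>

lemma continuous_on_jump:
  assumes "range d \<inter> X = {}"
  shows "continuous_on X (jump d)"
proof (rule uniform_limit_theorem)
  show "uniform_limit X (\<lambda>N x. \<Sum>n<N. of_bool (d n < x) / 5 ^ n) (jump d) sequentially"
    unfolding jump_def
  proof (rule Weierstrass_m_test)
    show "norm (of_bool (d n < x) / 5 ^ n :: real) \<le> (1 / 5) ^ n" for n x
      by (simp add: power_divide)
  qed simp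
  have "continuous_on X (\<lambda>x. of_bool (d n < x) / 5 ^ n :: real)" for n
  proof -
    have "continuous_on ({..<d n} \<union> {d n<..}) (\<lambda>x. of_bool (d n < x) :: real)"
    proof (rule continuous_on_open_Un)
      show "continuous_on {..<d n} (\<lambda>x. of_bool (d n < x) :: real)"
        by (rule continuous_on_eq[OF continuous_on_const[of _ 0]]) auto
      show "continuous_on {d n<..} (\<lambda>x. of_bool (d n < x) :: real)"
        by (rule continuous_on_eq[OF continuous_on_const[of _ 1]]) auto
    qed auto
    moreover have "d n \<notin> X" using assms by blast
    then have "X \<subseteq> {..<d n} \<union> {d n<..}" by (auto simp: not_less order_less_le)
    ultimately have "continuous_on X (\<lambda>x. of_bool (d n < x) :: real)" by (rule continuous_on_subset)
    then show ?thesis by (intro continuous_intros) auto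
  qed
  then show "\<forall>\<^sub>F N in sequentially. continuous_on X (\<lambda>x. \<Sum>n<N. of_bool (d n < x) / 5 ^ n :: real)"
    by (intro always_eventually allI continuous_on_sum) auto
qed simp

text \<open>On \<open>F\<close> the digits \<open>m\<close> and \<open>n\<close> differ only at
  \<open>p\<close>, so comparing them isolates \<open>p\<close>. Both \<open>d m\<close> and
  \<open>d n\<close> are taken closer to \<open>p\<close> than any other point of
  \<open>F\<close>.\<close>

lemma separate_point:
  assumes "finite F"
  obtains m n where "d m < p" "p \<le> d n" "\<And>x. x \<in> F \<Longrightarrow> d m < x \<longleftrightarrow> d n < x \<or> x = p"
proof -
  obtain \<delta> where \<delta>: "\<delta> > 0" "\<And>x. x \<in> F \<Longrightarrow> x \<noteq> p \<Longrightarrow> \<delta> \<le> dist p x"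
    using finite_set_avoid[OF assms, of p] by blast
  obtain m where m: "p - \<delta> < d m" "d m < p" using dense[of "p - \<delta>" p] \<delta>(1) by auto
  obtain n where n: "p < d n" "d n < p + \<delta>" using dense[of p "p + \<delta>"] \<delta>(1) by auto
  show thesis
  proof
    show "d m < x \<longleftrightarrow> d n < x \<or> x = p" if "x \<in> F" for x
      using \<delta>(2)[OF that] m n by (auto simp: dist_real_def)
  qed (use m n in auto)
qed

text \<open>The digits of a sum of three values lie in \<open>{0..3}\<close>, so the sum determines them; crossing a
  point \<open>p\<close> changes the digits by the multiplicity of \<open>p\<close> among the three arguments.\<close>

lemma sidon3_range_jump: "sidon3 (range (jump d))"
proof -
  have "{#a, b, c#} = {#a', b', c'#}"
    if eq: "jump d a + jump d b + jump d c = jump d a' + jump d b' + jump d c'"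
    for a b c a' b' c'
  proof -
    \<comment> \<open>\<open>D\<close> holds the digits of the difference of the two sums; three
      digits 0 or 1 on each side give the bound 3.\<close>
    define D :: "nat \<Rightarrow> int" where "D = (\<lambda>n. of_bool (d n < a) + of_bool (d n < b) + of_bool (d n < c)
      - of_bool (d n < a') - of_bool (d n < b') - of_bool (d n < c'))"
    have sums: "(\<lambda>n. of_bool (d n < x) / 5 ^ n) sums jump d x" for x
      unfolding jump_def by (rule summable_sums[OF jump_summable])
    have "(\<lambda>n. real_of_int (D n) / 5 ^ n) sums
        (jump d a + jump d b + jump d c - jump d a' - jump d b' - jump d c')"
      using sums_diff[OF sums_diff[OF sums_diff[OF sums_add[OF sums_add[OF sums[of a] sums[of b]]
        sums[of c]] sums[of a']] sums[of b']] sums[of c']]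
      by (simp add: D_def add_divide_distrib diff_divide_distrib)
    then have "(\<Sum>n. real_of_int (D n) / 5 ^ n) = 0" using eq by (simp add: sums_iff)
    moreover have "\<bar>D n\<bar> \<le> 3" for n by (simp add: D_def)
    ultimately have D: "D n = 0" for n by (rule base5_digits_zero[rotated])
    show ?thesis
    proof (rule multiset_eqI)
      fix p
      obtain m n where mn: "d m < p" "p \<le> d n"
        "\<And>x. x \<in> {a, b, c, a', b', c'} \<Longrightarrow> d m < x \<longleftrightarrow> d n < x \<or> x = p"
        using separate_point[of "{a, b, c, a', b', c'}" p] by auto
      have step: "of_bool (d m < x) = of_bool (d n < x) + (of_bool (x = p) :: int)"
        if "x \<in> {a, b, c, a', b', c'}" for x
        using mn(3)[OF that] mn(1,2) by auto
      have "of_bool (a = p) + of_bool (b = p) + of_bool (c = p) =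
          (of_bool (a' = p) + of_bool (b' = p) + of_bool (c' = p) :: int)"
        using D[of m] D[of n] unfolding D_def by (simp add: step)
      then show "count {#a, b, c#} p = count {#a', b', c'#} p"
        by (auto simp: of_bool_def split: if_splits)
    qed
  qed
  \<comment> \<open>So far the arguments agree as multisets; taking images under
    \<open>jump d\<close> gives the values.\<close>
  then have "{#jump d a, jump d b, jump d c#} = {#jump d a', jump d b', jump d c'#}"
    if "jump d a + jump d b + jump d c = jump d a' + jump d b' + jump d c'" for a b c a' b' c'
    using that by (metis image_mset_add_mset image_mset_empty)
  then show ?thesis unfolding sidon3_def by blast
qed

end

section \<open>Continuity of the inverse, and dense sequences avoiding a set\<close>

lemma homeomorphism_strict_mono:
  fixes f :: "real \<Rightarrow> real"
  assumes f: "strict_mono f" and cont: "continuous_on X f"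
  shows "homeomorphism X (f ` X) f (inv f)"
proof -
  have inv: "inv f (f x) = x" for x using strict_mono_imp_inj_on[OF f] by (rule inv_f_f)
  have "continuous_on (f ` X) (inv f)"
    unfolding continuous_on_def
  proof safe
    fix x assume "x \<in> X"
    show "(inv f \<longlongrightarrow> inv f (f x)) (at (f x) within f ` X)"
      unfolding inv
    proof (rule order_tendstoI)
      \<comment> \<open>\<open>f a\<close> bounds a neighbourhood of \<open>f x\<close> even when
        \<open>a\<close> is outside \<open>X\<close>, as \<open>f\<close> is increasing on the whole
        line.\<close>
      fix a assume "a < x"
      then have "\<forall>\<^sub>F y in at (f x) within f ` X. f a < y"
        by (intro order_tendstoD(1)[OF tendsto_ident_at]) (simp add: strict_mono_less[OF f])
      then show "\<forall>\<^sub>F y in at (f x) within f ` X. a < inv f y"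
        using f inv by (auto simp: eventually_at_filter strict_mono_less elim!: eventually_mono)
    next
      fix a assume "x < a"
      then have "\<forall>\<^sub>F y in at (f x) within f ` X. y < f a"
        by (intro order_tendstoD(2)[OF tendsto_ident_at]) (simp add: strict_mono_less[OF f])
      then show "\<forall>\<^sub>F y in at (f x) within f ` X. inv f y < a"
        using f inv by (auto simp: eventually_at_filter strict_mono_less elim!: eventually_mono)
    qed
  qed
  then show ?thesis using cont inv by (intro homeomorphismI) auto
qed

text \<open>The complement of \<open>X\<close> meets every interval, so a countable dense subset of
  the complement is dense in the line.\<close>

lemma dense_sequence_avoiding:
  fixes X :: "real set"
  assumes "totally_disconnected X"
  obtains d where "dense_sequence d" "range d \<inter> X = {}"
proof -
  obtain T where T: "countable T" "T \<subseteq> - X" "- X \<subseteq> closure T" using separable by blast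
  have meets: "\<exists>t\<in>T. a < t \<and> t < b" if "a < b" for a b :: real
  proof -
    \<comment> \<open>The characterisation speaks of closed intervals, hence one is placed strictly
      inside the open one.\<close>
    obtain a' b' where ab: "a < a'" "a' < b'" "b' < b" using \<open>a < b\<close> dense by metis
    then obtain z where z: "z \<in> {a'..b'}" "z \<notin> X"
      using assms unfolding totally_disconnected_real_iff by blast
    then have "z \<in> closure T \<inter> {a<..<b}" using T(3) ab by auto
    then have "{a<..<b} \<inter> closure T \<noteq> {}" by blast
    then have "{a<..<b} \<inter> T \<noteq> {}" using open_Int_closure_eq_empty[of "{a<..<b}" T] by auto
    then show ?thesis by auto
  qed
  then have "T \<noteq> {}" using zero_less_one by blast
  then have range: "range (from_nat_into T) = T" using T(1) by simp
  show thesis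
  proof
    show "dense_sequence (from_nat_into T)"
      using meets by unfold_locales (metis range rangeE)
    show "range (from_nat_into T) \<inter> X = {}" using T(2) range by auto
  qed
qed

theorem theorem2:
  fixes X :: "real set"
  assumes "infinite X"
  shows "\<exists>(Y :: real set) (\<phi> :: real \<Rightarrow> real).
    nowhere_dense Y \<and> Y \<in> null_sets lebesgue \<and>
    bij_betw \<phi> X Y \<and> strict_mono_on X \<phi> \<and>
    (totally_disconnected X \<longrightarrow> (\<exists>\<psi>. homeomorphism X Y \<phi> \<psi>)) \<and>
    (\<exists>S :: real set.
      partition_on UNIV ((\<lambda>\<xi>. (+) \<xi> ` Y) ` S) \<and>
      (\<lambda>\<xi>. (+) \<xi> ` Y) ` S \<approx> (UNIV :: real set))"
proof -
  \<comment> \<open>For \<open>X\<close> not totally disconnected, avoiding the empty set still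
    yields some dense sequence.\<close>
  have "totally_disconnected ({} :: real set)" by (simp add: totally_disconnected_def)
  then obtain d where d: "dense_sequence d" and avoid: "totally_disconnected X \<Longrightarrow> range d \<inter> X = {}"
    using dense_sequence_avoiding by metis
  interpret dense_sequence d by (rule d)
  define Y where "Y = jump d ` X"
  have inj: "inj_on (jump d) X"
    using strict_mono_imp_inj_on[OF strict_mono_jump] by (rule inj_on_subset[OF _ subset_UNIV])
  have infY: "infinite Y" unfolding Y_def using assms inj finite_image_iff by blast
  have sidon: "sidon3 Y" using sidon3_range_jump by (rule sidon3_subset) (auto simp: Y_def)
  obtain S where S: "\<And>x. \<exists>!s. s \<in> S \<and> x - s \<in> Y" using sidon3_tiles[OF sidon infY] by blast
  have "Y \<noteq> {}" using infY by auto
  note part = partition_translates[OF this S]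
  have "(\<lambda>\<xi>. (+) \<xi> ` Y) ` S \<approx> (UNIV :: real set)"
    using inj_on_image_eqpoll_self[OF part(2)] sidon3_tiling_eqpoll[OF sidon infY S] by (rule eqpoll_trans)
  moreover have "Y \<subseteq> base5_cantor" using jump_in_cantor by (auto simp: Y_def)
  then have "closure Y \<subseteq> closure base5_cantor" by (rule closure_mono)
  then have neg: "negligible (closure Y)" by (rule negligible_subset[OF negligible_closure_base5_cantor])
  \<comment> \<open>A nonempty open set is not negligible, so the null closure has empty
    interior.\<close>
  then have "nowhere_dense Y"
    unfolding nowhere_dense_def using negligible_subset[OF neg interior_subset] open_interior
      open_not_negligible by blast
  moreover have "Y \<in> null_sets lebesgue"
    using negligible_subset[OF neg closure_subset] by (simp add: negligible_iff_null_sets)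
  moreover have "bij_betw (jump d) X Y" using inj by (simp add: Y_def bij_betw_def)
  moreover have "strict_mono_on X (jump d)"
    using strict_mono_jump by (rule monotone_on_subset) simp
  moreover have "homeomorphism X Y (jump d) (inv (jump d))" if "totally_disconnected X"
    unfolding Y_def
    by (rule homeomorphism_strict_mono[OF strict_mono_jump continuous_on_jump[OF avoid[OF that]]])
  ultimately show ?thesis using part(1) by blast
qed

end
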